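(* Let $m,n$ be positive integers, and suppose that the polynomial $\mathrm{Tr}[(A+tB)^{m-1}]$ in $t$ has nonnegative coefficients for each pair of $n \times n$ positive semidefinite matrices $A$ and $B$. If $p(t) = \mathrm{Tr}[(A+tB)^m]$ has nonnegative coefficients whenever $A$ and $B$ are both singular $n \times n$ positive semidefinite matrices, then $p(t) = \mathrm{Tr}[(A+tB)^m]$ has nonnegative coefficients whenever $A$ and $B$ are arbitrary $n \times n$ positive semidefinite matrices.
   Context: Matrices are complex. A positive semidefinite matrix is a complex Hermitian matrix all of whose eigenvalues are nonnegative. For Hermitian $A,B$ the polynomial $\mathrm{Tr}[(A+tB)^m]$ in $t$ has real coefficients. *)

theory Defs
  imports "Jordan_Normal_Form.Schur_Decomposition"
begin

(* On complex, 0 \<le> z is the order of HOL-Library.Complex_Order: z is real and nonnegative. *)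

definition psd_mat :: "complex mat \<Rightarrow> bool" where
  "psd_mat A \<longleftrightarrow> square_mat A \<and> mat_adjoint A = A \<and> (\<forall>k. eigenvalue A k \<longrightarrow> 0 \<le> k)"

definition singular_mat :: "complex mat \<Rightarrow> bool" where
  "singular_mat A \<longleftrightarrow> square_mat A \<and> \<not> invertible_mat A"

definition mat_trace :: "'a :: comm_monoid_add mat \<Rightarrow> 'a" where
  "mat_trace A = (\<Sum>i<dim_row A. A $$ (i, i))"

(* Tr[(A + t B)^m] as a formal polynomial in t: the power and the trace are taken
   over the ring of complex polynomials, with t = [:0, 1:]. *)
definition trace_poly :: "nat \<Rightarrow> complex mat \<Rightarrow> complex mat \<Rightarrow> complex poly" where
  "trace_poly m A B =
     mat_trace ((map_mat (\<lambda>a. [:a:]) A + [:0, 1:] \<cdot>\<^sub>m map_mat (\<lambda>b. [:b:]) B) ^\<^sub>m m)"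

definition nonneg_coeffs :: "complex poly \<Rightarrow> bool" where
  "nonneg_coeffs p \<longleftrightarrow> (\<forall>k. 0 \<le> coeff p k)"

lemma poly_trace_poly:
  assumes A: "A \<in> carrier_mat n n" and B: "B \<in> carrier_mat n n"
  shows "poly (trace_poly m A B) t = mat_trace ((A + t \<cdot>\<^sub>m B) ^\<^sub>m m)"
proof -
  have ev: "semiring_hom (\<lambda>p. poly p t)"
    by unfold_locales auto
  let ?M = "map_mat (\<lambda>a. [:a:]) A + [:0, 1:] \<cdot>\<^sub>m map_mat (\<lambda>b. [:b:]) B"
  have M: "?M \<in> carrier_mat n n" using A B by auto
  have ev_M: "map_mat (\<lambda>p. poly p t) ?M = A + t \<cdot>\<^sub>m B"
    using A B by (intro eq_matI) auto
  have pow: "?M ^\<^sub>m m \<in> carrier_mat n n" using M by (rule pow_carrier_mat)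
  have "poly (trace_poly m A B) t = mat_trace (map_mat (\<lambda>p. poly p t) (?M ^\<^sub>m m))"
    using carrier_matD[OF pow]
    by (simp add: trace_poly_def mat_trace_def poly_sum del: pow_mat_dim pow_mat_dim_square)
  also have "\<dots> = mat_trace ((A + t \<cdot>\<^sub>m B) ^\<^sub>m m)"
    using semiring_hom.mat_hom_pow[OF ev M, of m] ev_M by simp
  finally show ?thesis .
qed

end

theory Submission
  imports Defs "Jordan_Normal_Form.Spectral_Radius"
begin

text \<open>
  Write \<open>A = A\<^sub>0 + a I\<close> and \<open>B = B\<^sub>0 + b I\<close>, where \<open>a\<close> and \<open>b\<close> are the least eigenvalues of \<open>A\<close> and
  \<open>B\<close>. Then \<open>A\<^sub>0\<close> and \<open>B\<^sub>0\<close> are singular and still positive semidefinite, so the coefficients of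
  \<open>Tr[(A\<^sub>0 + t B\<^sub>0)^m]\<close> are nonnegative, and it suffices that they do not decrease when multiples of
  the identity are added back to either matrix. The identity commutes with everything, hence for all
  Hermitian \<open>A\<close> and \<open>B\<close>
  \<open>d/ds Tr[(A + s I + t B)^m] = m Tr[(A + s I + t B)^(m-1)]\<close> and
  \<open>d/ds Tr[(A + t (B + s I))^m] = m t Tr[(A + t (B + s I))^(m-1)]\<close>. If \<open>A\<close> and \<open>B\<close>
  are positive semidefinite and \<open>s \<ge> 0\<close>, then so are \<open>A + s I\<close> and \<open>B + s I\<close>, and the right-hand sides
  have nonnegative coefficients by the assumption on exponent \<open>m - 1\<close>.

  Both derivatives are instances of \<open>trace_pow_shift_derivative\<close>, where a polynomial multiple
  \<open>s P I\<close> of the identity is added, with \<open>P = 1\<close> or \<open>P = t\<close>. The two monotonicity steps are instances of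
  \<open>nonneg_coeffs_shift\<close>, and the decompositions of \<open>A\<close> and \<open>B\<close> come from \<open>psd_singular_plus_scalar\<close>.
\<close>

section \<open>Differentiating matrix powers of polynomials in a parameter\<close>

text \<open>
  Only the individual coefficients matter later, so a polynomial depending on a real parameter is
  differentiated coefficient by coefficient. The product rule survives because each coefficient of a product is a finite sum of products.
\<close>

definition coeffs_deriv :: "(real \<Rightarrow> complex poly) \<Rightarrow> complex poly \<Rightarrow> real \<Rightarrow> bool" where
  "coeffs_deriv f f' s \<longleftrightarrow>
     (\<forall>k. ((\<lambda>x. coeff (f x) k) has_vector_derivative coeff f' k) (at s))"

lemma coeffs_deriv_const: "coeffs_deriv (\<lambda>x. c) 0 s"
  by (simp add: coeffs_deriv_def)

lemma coeffs_deriv_scale: "coeffs_deriv (\<lambda>x. smult (complex_of_real x) p) p s"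
  unfolding coeffs_deriv_def by (auto intro!: derivative_eq_intros)

lemma coeffs_deriv_add:
  "coeffs_deriv f f' s \<Longrightarrow> coeffs_deriv g g' s \<Longrightarrow> coeffs_deriv (\<lambda>x. f x + g x) (f' + g') s"
  unfolding coeffs_deriv_def by (auto intro!: derivative_intros)

lemma coeffs_deriv_sum:
  assumes "\<And>i. i \<in> I \<Longrightarrow> coeffs_deriv (f i) (f' i) s"
  shows "coeffs_deriv (\<lambda>x. \<Sum>i\<in>I. f i x) (\<Sum>i\<in>I. f' i) s"
  using assms unfolding coeffs_deriv_def coeff_sum by (auto intro!: derivative_intros)

lemma coeffs_deriv_mult:
  assumes "coeffs_deriv f f' s" "coeffs_deriv g g' s"
  shows "coeffs_deriv (\<lambda>x. f x * g x) (f s * g' + f' * g s) s"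
proof -
  have "((\<lambda>x. \<Sum>i\<le>k. coeff (f x) i * coeff (g x) (k - i)) has_vector_derivative
      (\<Sum>i\<le>k. coeff (f s) i * coeff g' (k - i) + coeff f' i * coeff (g s) (k - i))) (at s)" for k
    using assms by (intro has_vector_derivative_sum has_vector_derivative_mult)
      (auto simp: coeffs_deriv_def)
  then show ?thesis by (simp add: coeffs_deriv_def coeff_mult sum.distrib)
qed

text \<open>
  The power rule holds although matrices do not commute, because the derivative \<open>p I\<close> of the base
  does commute with the base. For \<open>m = 0\<close> the factor \<open>of_nat m\<close> makes the truncated exponent \<open>m - 1\<close>
  harmless.
\<close>

lemma mat_pow_shift_derivative:
  fixes M :: "complex poly mat" and p :: "complex poly"
  assumes M: "M \<in> carrier_mat n n"
  defines "X \<equiv> \<lambda>s. M + smult (complex_of_real s) p \<cdot>\<^sub>m 1\<^sub>m n"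
  assumes "i < n" "j < n"
  shows "coeffs_deriv (\<lambda>s. (X s ^\<^sub>m m) $$ (i, j)) (of_nat m * p * (X s ^\<^sub>m (m - 1)) $$ (i, j)) s"
  using \<open>j < n\<close>
proof (induction m arbitrary: j)
  case 0
  have "dim_row (X x) = n" for x using M by (simp add: X_def)
  then show ?case using \<open>i < n\<close> 0 by (simp add: coeffs_deriv_const)
next
  case (Suc m)
  have X: "X x \<in> carrier_mat n n" for x using M by (simp add: X_def)
  have P: "X x ^\<^sub>m l \<in> carrier_mat n n" for x l using X by simp
  have step: "(X x ^\<^sub>m Suc l) $$ (i, j) = (\<Sum>k<n. (X x ^\<^sub>m l) $$ (i, k) * X x $$ (k, j))" for x l
    using \<open>i < n\<close> Suc.prems carrier_matD[OF P] carrier_matD[OF X]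
    by (simp add: scalar_prod_def lessThan_atLeast0 del: pow_mat_dim pow_mat_dim_square)
  have dX: "coeffs_deriv (\<lambda>x. X x $$ (k, j)) (if k = j then p else 0) s" if "k < n" for k
  proof (cases "k = j")
    case True
    then have "X x $$ (k, j) = M $$ (k, j) + smult (complex_of_real x) p" for x
      using that Suc.prems M by (simp add: X_def)
    then show ?thesis
      using coeffs_deriv_add[OF coeffs_deriv_const coeffs_deriv_scale] True by simp
  next
    case False
    then have "X x $$ (k, j) = M $$ (k, j)" for x
      using that Suc.prems M by (simp add: X_def)
    then show ?thesis using coeffs_deriv_const False by simp
  qed
  have deriv: "coeffs_deriv (\<lambda>x. (X x ^\<^sub>m Suc m) $$ (i, j))
      (\<Sum>k<n. (X s ^\<^sub>m m) $$ (i, k) * (if k = j then p else 0)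
            + of_nat m * p * (X s ^\<^sub>m (m - 1)) $$ (i, k) * X s $$ (k, j)) s"
    unfolding step by (intro coeffs_deriv_sum coeffs_deriv_mult Suc.IH dX) auto
  have "(\<Sum>k<n. (X s ^\<^sub>m m) $$ (i, k) * (if k = j then p else 0)) = p * (X s ^\<^sub>m m) $$ (i, j)"
    using Suc.prems by (simp add: if_distrib[of "\<lambda>y. _ * y"] sum.delta cong: if_cong)
  moreover have "(\<Sum>k<n. of_nat m * p * (X s ^\<^sub>m (m - 1)) $$ (i, k) * X s $$ (k, j))
      = of_nat m * p * (X s ^\<^sub>m m) $$ (i, j)"
  proof (cases m)
    case (Suc l)
    then show ?thesis using step[of s l] by (simp add: sum_distrib_left mult.assoc)
  qed simp
  ultimately show ?case using deriv by (simp add: sum.distrib algebra_simps)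
qed

lemma trace_pow_shift_derivative:
  fixes M :: "complex poly mat" and p :: "complex poly"
  assumes M: "M \<in> carrier_mat n n"
  defines "X \<equiv> \<lambda>s. M + smult (complex_of_real s) p \<cdot>\<^sub>m 1\<^sub>m n"
  shows "coeffs_deriv (\<lambda>s. mat_trace (X s ^\<^sub>m m)) (of_nat m * p * mat_trace (X s ^\<^sub>m (m - 1))) s"
proof -
  have "X x ^\<^sub>m l \<in> carrier_mat n n" for x l using M by (simp add: X_def)
  then have "dim_row (X x ^\<^sub>m l) = n" for x l by (rule carrier_matD)
  then have tr: "mat_trace (X x ^\<^sub>m l) = (\<Sum>i<n. (X x ^\<^sub>m l) $$ (i, i))" for x l
    unfolding mat_trace_def by (simp only:)
  show ?thesis
    unfolding tr sum_distrib_left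
    by (rule coeffs_deriv_sum) (simp add: X_def mat_pow_shift_derivative[OF M] del: One_nat_def)
qed

section \<open>Monotonicity of the coefficients\<close>

lemma nonneg_coeffs_mult:
  "nonneg_coeffs p \<Longrightarrow> nonneg_coeffs q \<Longrightarrow> nonneg_coeffs (p * q)"
  unfolding nonneg_coeffs_def coeff_mult by (auto intro!: sum_nonneg mult_nonneg_nonneg)

text \<open>
  In the order on the complex numbers, a nonnegative derivative makes the real part nondecreasing and
  the imaginary part constant. So nonnegativity, which includes being real, propagates from \<open>0\<close>.
\<close>

lemma nonneg_coeffs_if_deriv_nonneg:
  assumes "0 \<le> c" and start: "nonneg_coeffs (f 0)"
    and deriv: "\<And>s. 0 \<le> s \<Longrightarrow> coeffs_deriv f (f' s) s"
    and nonneg: "\<And>s. 0 \<le> s \<Longrightarrow> nonneg_coeffs (f' s)"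
  shows "nonneg_coeffs (f c)"
  unfolding nonneg_coeffs_def
proof
  fix k
  have d: "((\<lambda>x. Re (coeff (f x) k)) has_real_derivative Re (coeff (f' s) k)) (at s)"
    "((\<lambda>x. Im (coeff (f x) k)) has_real_derivative Im (coeff (f' s) k)) (at s)" if "0 \<le> s" for s
    using deriv[OF that] by (auto simp: coeffs_deriv_def has_vector_derivative_complex_iff)
  have n: "0 \<le> Re (coeff (f' s) k)" "0 \<le> Im (coeff (f' s) k)" "Im (coeff (f' s) k) \<le> 0" if "0 \<le> s" for s
    using nonneg[OF that] by (auto simp: nonneg_coeffs_def less_eq_complex_def)
  have "Re (coeff (f 0) k) \<le> Re (coeff (f c) k)"
    using \<open>0 \<le> c\<close> by (rule DERIV_nonneg_imp_nondecreasing) (intro exI conjI, erule d(1), erule n(1))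
  moreover have "Im (coeff (f 0) k) \<le> Im (coeff (f c) k)"
    using \<open>0 \<le> c\<close> by (rule DERIV_nonneg_imp_nondecreasing) (intro exI conjI, erule d(2), erule n(2))
  moreover have "Im (coeff (f c) k) \<le> Im (coeff (f 0) k)"
    using \<open>0 \<le> c\<close> by (rule DERIV_nonpos_imp_nonincreasing) (intro exI conjI, erule d(2), erule n(3))
  moreover have "0 \<le> coeff (f 0) k"
    using start by (simp add: nonneg_coeffs_def)
  ultimately show "0 \<le> coeff (f c) k"
    by (simp add: less_eq_complex_def)
qed

text \<open>
  The polynomial \<open>p\<close> is there to treat both matrices at once: in \<open>A + t B\<close>, adding \<open>s I\<close> to \<open>A\<close> adds
  \<open>s I\<close> to the sum, and adding \<open>s I\<close> to \<open>B\<close> adds \<open>s t I\<close>. Nonnegativity of \<open>p\<close> keeps the derivative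
  \<open>m p Tr[(M + s p I)^(m-1)]\<close> nonnegative.
\<close>

lemma nonneg_coeffs_shift:
  fixes M :: "complex poly mat" and p :: "complex poly"
  assumes M: "M \<in> carrier_mat n n" and "0 \<le> c" and p: "nonneg_coeffs p"
  defines "X \<equiv> \<lambda>s. M + smult (complex_of_real s) p \<cdot>\<^sub>m 1\<^sub>m n"
  assumes start: "nonneg_coeffs (mat_trace (M ^\<^sub>m m))"
    and lower: "\<And>s. 0 \<le> s \<Longrightarrow> nonneg_coeffs (mat_trace (X s ^\<^sub>m (m - 1)))"
  shows "nonneg_coeffs (mat_trace (X c ^\<^sub>m m))"
proof (rule nonneg_coeffs_if_deriv_nonneg[OF \<open>0 \<le> c\<close>, where f = "\<lambda>s. mat_trace (X s ^\<^sub>m m)"])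
  have "X 0 = M" unfolding X_def using M by (intro eq_matI) auto
  then show "nonneg_coeffs (mat_trace (X 0 ^\<^sub>m m))" using start by simp
next
  fix s :: real assume "0 \<le> s"
  show "coeffs_deriv (\<lambda>s. mat_trace (X s ^\<^sub>m m)) (of_nat m * p * mat_trace (X s ^\<^sub>m (m - 1))) s"
    unfolding X_def by (rule trace_pow_shift_derivative[OF M])
  have "nonneg_coeffs (of_nat m)"
    by (auto simp: nonneg_coeffs_def of_nat_poly coeff_pCons less_eq_complex_def split: nat.split)
  then show "nonneg_coeffs (of_nat m * p * mat_trace (X s ^\<^sub>m (m - 1)))"
    using p lower[OF \<open>0 \<le> s\<close>] by (intro nonneg_coeffs_mult)
qed

section \<open>Scalar shifts of positive semidefinite matrices\<close>

lemma mat_adjoint_index: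
  assumes "A \<in> carrier_mat n n" "i < n" "j < n"
  shows "mat_adjoint A $$ (i, j) = conjugate (A $$ (j, i))"
  using assms by (simp add: mat_adjoint_def mat_of_rows_index)

lemma hermitian_plus_real_scalar:
  assumes A: "A \<in> carrier_mat n n" and h: "mat_adjoint A = A"
  shows "mat_adjoint (A + complex_of_real c \<cdot>\<^sub>m 1\<^sub>m n) = A + complex_of_real c \<cdot>\<^sub>m 1\<^sub>m n"
    (is "mat_adjoint ?S = ?S")
proof (rule eq_matI)
  have S: "?S \<in> carrier_mat n n" using A by simp
  fix i j assume "i < dim_row ?S" "j < dim_col ?S"
  then have ij: "i < n" "j < n" using S by auto
  have "A $$ (i, j) = conjugate (A $$ (j, i))"
    using mat_adjoint_index[OF A ij] h by simp
  then show "mat_adjoint ?S $$ (i, j) = ?S $$ (i, j)"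
    using mat_adjoint_index[OF S ij] ij A by simp
qed (use A in \<open>auto simp: mat_adjoint_def\<close>)

lemma eigenvalue_plus_scalar:
  fixes A :: "'a :: comm_ring_1 mat"
  assumes A: "A \<in> carrier_mat n n"
  shows "eigenvalue (A + c \<cdot>\<^sub>m 1\<^sub>m n) k \<longleftrightarrow> eigenvalue A (k - c)"
proof -
  have "(A + c \<cdot>\<^sub>m 1\<^sub>m n) *\<^sub>v v = k \<cdot>\<^sub>v v \<longleftrightarrow> A *\<^sub>v v = (k - c) \<cdot>\<^sub>v v" if v: "v \<in> carrier_vec n" for v
  proof -
    have "(c \<cdot>\<^sub>m 1\<^sub>m n) *\<^sub>v v = c \<cdot>\<^sub>v v"
      using v by (intro eq_vecI) auto
    then have "(A + c \<cdot>\<^sub>m 1\<^sub>m n) *\<^sub>v v = A *\<^sub>v v + c \<cdot>\<^sub>v v"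
      by (simp add: add_mult_distrib_mat_vec[OF A _ v])
    moreover have "A *\<^sub>v v + c \<cdot>\<^sub>v v = k \<cdot>\<^sub>v v \<longleftrightarrow> A *\<^sub>v v = (k - c) \<cdot>\<^sub>v v"
      using A v by (auto simp: vec_eq_iff algebra_simps)
    ultimately show ?thesis by simp
  qed
  then show ?thesis using A by (auto simp: eigenvalue_def eigenvector_def)
qed

lemma psd_plus_scalar:
  assumes A: "A \<in> carrier_mat n n" and psd: "psd_mat A" and "0 \<le> c"
  shows "psd_mat (A + complex_of_real c \<cdot>\<^sub>m 1\<^sub>m n)"
proof -
  have "0 \<le> k" if "eigenvalue (A + complex_of_real c \<cdot>\<^sub>m 1\<^sub>m n) k" for k
  proof -
    have "0 \<le> k - complex_of_real c"
      using that psd eigenvalue_plus_scalar[OF A] by (auto simp: psd_mat_def)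
    then show ?thesis using \<open>0 \<le> c\<close> by (simp add: less_eq_complex_def)
  qed
  then show ?thesis
    using A psd hermitian_plus_real_scalar[OF A] by (auto simp: psd_mat_def)
qed

lemma singular_mat_if_eigenvalue_zero:
  fixes A :: "complex mat"
  assumes A: "A \<in> carrier_mat n n" and "eigenvalue A 0"
  shows "singular_mat A"
proof -
  obtain v where v: "v \<in> carrier_vec n" "v \<noteq> 0\<^sub>v n" "A *\<^sub>v v = 0 \<cdot>\<^sub>v v"
    using assms by (auto simp: eigenvalue_def eigenvector_def)
  have "\<not> invertible_mat A"
  proof
    assume "invertible_mat A"
    then obtain B where AB: "A * B = 1\<^sub>m n" and BA: "B * A = 1\<^sub>m (dim_row B)"
      using A by (auto simp: invertible_mat_def inverts_mat_def)
    have "dim_col B = n" using arg_cong[OF AB, of dim_col] by simp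
    moreover have "dim_row B = n" using arg_cong[OF BA, of dim_col] A by simp
    ultimately have B: "B \<in> carrier_mat n n" by auto
    have "v = (B * A) *\<^sub>v v" using v(1) BA B by simp
    also have "\<dots> = B *\<^sub>v (0 \<cdot>\<^sub>v v)" using assoc_mult_mat_vec[OF B A v(1)] v(3) by simp
    also have "\<dots> = 0\<^sub>v n" using B v(1) by auto
    finally show False using v(2) by simp
  qed
  then show ?thesis using A by (auto simp: singular_mat_def)
qed

text \<open>The scalar is the least eigenvalue, whose subtraction leaves \<open>0\<close> as the least eigenvalue.\<close>

lemma psd_singular_plus_scalar:
  assumes A: "A \<in> carrier_mat n n" and psd: "psd_mat A" and "0 < n"
  obtains A\<^sub>0 a where "A\<^sub>0 \<in> carrier_mat n n" "psd_mat A\<^sub>0" "singular_mat A\<^sub>0" "0 \<le> a"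
    "A = A\<^sub>0 + complex_of_real a \<cdot>\<^sub>m 1\<^sub>m n"
proof -
  define a where "a = Min (Re ` spectrum A)"
  have fin: "finite (Re ` spectrum A)" and ne: "Re ` spectrum A \<noteq> {}"
    using card_finite_spectrum(1)[OF A] spectrum_non_empty[OF A \<open>0 < n\<close>] by auto
  have real: "k = complex_of_real (Re k)" "0 \<le> Re k" if "eigenvalue A k" for k
    using psd that by (auto simp: psd_mat_def less_eq_complex_def complex_eq_iff)
  obtain l where l: "eigenvalue A l" "a = Re l"
    using Min_in[OF fin ne] by (auto simp: a_def spectrum_def)
  have least: "a \<le> Re k" if "eigenvalue A k" for k
    using fin that by (auto simp: a_def spectrum_def)
  define A\<^sub>0 where "A\<^sub>0 = A + complex_of_real (- a) \<cdot>\<^sub>m 1\<^sub>m n"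
  have A\<^sub>0: "A\<^sub>0 \<in> carrier_mat n n" using A by (simp add: A\<^sub>0_def)
  have ev: "eigenvalue A\<^sub>0 k \<longleftrightarrow> eigenvalue A (k + complex_of_real a)" for k
    using eigenvalue_plus_scalar[OF A] by (simp add: A\<^sub>0_def)
  have "0 \<le> k" if "eigenvalue A\<^sub>0 k" for k
    using real[of "k + complex_of_real a"] least[of "k + complex_of_real a"] that
    by (auto simp: ev less_eq_complex_def complex_eq_iff)
  moreover have "mat_adjoint A\<^sub>0 = A\<^sub>0"
    unfolding A\<^sub>0_def using psd by (intro hermitian_plus_real_scalar[OF A]) (simp add: psd_mat_def)
  ultimately have "psd_mat A\<^sub>0" using A\<^sub>0 by (auto simp: psd_mat_def)
  moreover have "singular_mat A\<^sub>0"
    using l real(1)[OF l(1)] by (intro singular_mat_if_eigenvalue_zero[OF A\<^sub>0]) (simp add: ev)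
  moreover have "A = A\<^sub>0 + complex_of_real a \<cdot>\<^sub>m 1\<^sub>m n"
    unfolding A\<^sub>0_def using A by (intro eq_matI) auto
  moreover have "0 \<le> a" using l real by simp
  ultimately show ?thesis using that A\<^sub>0 by blast
qed

section \<open>Reduction to singular matrices\<close>

abbreviation poly_pencil :: "complex mat \<Rightarrow> complex mat \<Rightarrow> complex poly mat" where
  "poly_pencil A B \<equiv> map_mat (\<lambda>a. [:a:]) A + [:0, 1:] \<cdot>\<^sub>m map_mat (\<lambda>b. [:b:]) B"

lemma poly_pencil_shift_left:
  assumes "A \<in> carrier_mat n n" "B \<in> carrier_mat n n"
  shows "poly_pencil (A + c \<cdot>\<^sub>m 1\<^sub>m n) B = poly_pencil A B + smult c 1 \<cdot>\<^sub>m 1\<^sub>m n"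
  using assms by (intro eq_matI) auto

lemma poly_pencil_shift_right:
  assumes "A \<in> carrier_mat n n" "B \<in> carrier_mat n n"
  shows "poly_pencil A (B + c \<cdot>\<^sub>m 1\<^sub>m n) = poly_pencil A B + smult c [:0, 1:] \<cdot>\<^sub>m 1\<^sub>m n"
  using assms by (intro eq_matI) auto

theorem theorem1p12:
  fixes m n :: nat
  assumes "0 < m" and "0 < n"
    and "\<And>A B. \<lbrakk>A \<in> carrier_mat n n; B \<in> carrier_mat n n; psd_mat A; psd_mat B\<rbrakk>
           \<Longrightarrow> nonneg_coeffs (trace_poly (m - 1) A B)"
    and "\<And>A B. \<lbrakk>A \<in> carrier_mat n n; B \<in> carrier_mat n n; psd_mat A; psd_mat B;
                  singular_mat A; singular_mat B\<rbrakk>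
           \<Longrightarrow> nonneg_coeffs (trace_poly m A B)"
  shows "\<forall>A B. A \<in> carrier_mat n n \<longrightarrow> B \<in> carrier_mat n n \<longrightarrow> psd_mat A \<longrightarrow> psd_mat B
           \<longrightarrow> nonneg_coeffs (trace_poly m A B)"
proof (intro allI impI)
  fix A B :: "complex mat"
  assume A: "A \<in> carrier_mat n n" "psd_mat A" and B: "B \<in> carrier_mat n n" "psd_mat B"
  obtain A\<^sub>0 a where A\<^sub>0: "A\<^sub>0 \<in> carrier_mat n n" "psd_mat A\<^sub>0" "singular_mat A\<^sub>0" and "0 \<le> a"
    and A_eq: "A = A\<^sub>0 + complex_of_real a \<cdot>\<^sub>m 1\<^sub>m n"
    using psd_singular_plus_scalar A \<open>0 < n\<close> by blast
  obtain B\<^sub>0 b where B\<^sub>0: "B\<^sub>0 \<in> carrier_mat n n" "psd_mat B\<^sub>0" "singular_mat B\<^sub>0" and "0 \<le> b"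
    and B_eq: "B = B\<^sub>0 + complex_of_real b \<cdot>\<^sub>m 1\<^sub>m n"
    using psd_singular_plus_scalar B \<open>0 < n\<close> by blast
  have one: "nonneg_coeffs 1" and t: "nonneg_coeffs [:0, 1:]"
    by (auto simp: nonneg_coeffs_def coeff_pCons less_eq_complex_def split: nat.split)
  note lower = assms(3)[unfolded trace_poly_def]
  have A0_B0: "nonneg_coeffs (mat_trace (poly_pencil A\<^sub>0 B\<^sub>0 ^\<^sub>m m))"
    using assms(4)[of A\<^sub>0 B\<^sub>0] A\<^sub>0 B\<^sub>0 by (simp add: trace_poly_def)
  (* The scalar parts are restored one at a time. Along both paths the pair stays positive
     semidefinite, which is what the hypothesis on exponent m - 1 asks for. *)
  have A_B0: "nonneg_coeffs (mat_trace (poly_pencil A B\<^sub>0 ^\<^sub>m m))"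
    unfolding A_eq poly_pencil_shift_left[OF A\<^sub>0(1) B\<^sub>0(1)]
  proof (rule nonneg_coeffs_shift[OF _ \<open>0 \<le> a\<close> one])
    show "poly_pencil A\<^sub>0 B\<^sub>0 \<in> carrier_mat n n" using A\<^sub>0 B\<^sub>0 by simp
    show "nonneg_coeffs (mat_trace (poly_pencil A\<^sub>0 B\<^sub>0 ^\<^sub>m m))" by (rule A0_B0)
    fix s :: real assume "0 \<le> s"
    then show "nonneg_coeffs (mat_trace ((poly_pencil A\<^sub>0 B\<^sub>0
        + smult (complex_of_real s) 1 \<cdot>\<^sub>m 1\<^sub>m n) ^\<^sub>m (m - 1)))"
      unfolding poly_pencil_shift_left[OF A\<^sub>0(1) B\<^sub>0(1), symmetric]
      using A\<^sub>0 B\<^sub>0 by (intro lower psd_plus_scalar) auto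
  qed
  have A_B: "nonneg_coeffs (mat_trace (poly_pencil A B ^\<^sub>m m))"
    unfolding B_eq poly_pencil_shift_right[OF A(1) B\<^sub>0(1)]
  proof (rule nonneg_coeffs_shift[OF _ \<open>0 \<le> b\<close> t])
    show "poly_pencil A B\<^sub>0 \<in> carrier_mat n n" using A B\<^sub>0 by simp
    show "nonneg_coeffs (mat_trace (poly_pencil A B\<^sub>0 ^\<^sub>m m))" by (rule A_B0)
    fix s :: real assume "0 \<le> s"
    then show "nonneg_coeffs (mat_trace ((poly_pencil A B\<^sub>0
        + smult (complex_of_real s) [:0, 1:] \<cdot>\<^sub>m 1\<^sub>m n) ^\<^sub>m (m - 1)))"
      unfolding poly_pencil_shift_right[OF A(1) B\<^sub>0(1), symmetric]
      using A B\<^sub>0 by (intro lower psd_plus_scalar) auto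
  qed
  show "nonneg_coeffs (trace_poly m A B)" using A_B by (simp only: trace_poly_def)
qed

end
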